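(* Let $\{\pi_n\}_{n\ge 0}$ be the monic Hermite polynomials, i.e. $\pi_0(x)=1$, $\pi_1(x)=x$ and $\pi_{n+1}(x)=x\pi_n(x)-\frac n2\pi_{n-1}(x)$ for $n\ge 1$. Then, as $n\to\infty$, $$\pi_n(\sqrt{2n}\,y)\sim\left(\frac{n}{2e}\right)^{n/2}\exp\left\{n\left[y^2-y\sqrt{y^2-1}+\log\left(y+\sqrt{y^2-1}\right)\right]\right\}\left(\frac{y+\sqrt{y^2-1}}{2\sqrt{y^2-1}}\right)^{1/2}$$ for complex $y$ bounded away from the interval $[-1,1]$; that is, for every $\eta>0$ the ratio of the two sides tends to $1$ as $n\to\infty$, uniformly for $y\in\mathbb{C}$ with $\mathrm{dist}(y,[-1,1])\ge\eta$.
   Context: The polynomials satisfy $\pi_n(x)=2^{-n}H_n(x)$, where $H_n$ is the (physicists') Hermite polynomial. The square root $\sqrt{y^2-1}$ is the branch analytic in $\mathbb{C}\setminus[-1,1]$ with $\sqrt{y^2-1}\sim y$ as $y\to\infty$. The outer power $1/2$ is the principal branch (its argument has positive real part for $y\notin[-1,1]$). The choice of the value of the logarithm is immaterial, since it is multiplied by the integer $n$ and exponentiated. *)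

theory Defs
  imports "HOL-Complex_Analysis.Complex_Analysis" "HOL-Computational_Algebra.Polynomial"
begin

fun monic_hermite :: "nat \<Rightarrow> complex poly" where
  "monic_hermite 0 = 1"
| "monic_hermite (Suc 0) = [:0, 1:]"
| "monic_hermite (Suc (Suc n)) =
     [:0, 1:] * monic_hermite (Suc n) - smult (of_nat (Suc n) / 2) (monic_hermite n)"

abbreviation unit_cut :: "complex set" where
  "unit_cut \<equiv> closed_segment (-1) 1"

text \<open>The branch of the square root of \<open>y\<^sup>2 - 1\<close>, as a predicate on functions that ignores
  their values on the cut. Off the cut exactly one function satisfies it; see
  \<open>is_sqrt_branch_csqrt\<close> and \<open>is_sqrt_branch_unique\<close> below.\<close>

definition is_sqrt_branch :: "(complex \<Rightarrow> complex) \<Rightarrow> bool" where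
  "is_sqrt_branch r \<longleftrightarrow>
     r analytic_on (- unit_cut) \<and>
     (\<forall>y. y \<notin> unit_cut \<longrightarrow> (r y)\<^sup>2 = y\<^sup>2 - 1) \<and>
     ((\<lambda>y. r y / y) \<longlongrightarrow> 1) at_infinity"

lemma cut_iff: "z \<in> unit_cut \<longleftrightarrow> Im z = 0 \<and> \<bar>Re z\<bar> \<le> 1"
proof -
  have "z \<in> unit_cut \<longleftrightarrow> complex_of_real (Re z) \<in> closed_segment (of_real (-1)) (of_real 1) \<and> Im z = 0"
    by (auto simp: closed_segment_def complex_eq_iff)
  also have "\<dots> \<longleftrightarrow> Re z \<in> closed_segment (-1) 1 \<and> Im z = 0"
    by (subst of_real_closed_segment) auto
  also have "\<dots> \<longleftrightarrow> Im z = 0 \<and> \<bar>Re z\<bar> \<le> 1"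
    by (auto simp: closed_segment_eq_real_ivl)
  finally show ?thesis .
qed

lemma is_sqrt_branch_csqrt: "is_sqrt_branch (\<lambda>y. y * csqrt (1 - 1 / y\<^sup>2))"
  unfolding is_sqrt_branch_def
proof (intro conjI allI impI)
  have nz: "y \<noteq> 0" if "y \<notin> unit_cut" for y
    using that by (auto simp: cut_iff)
  have "1 - 1 / y\<^sup>2 \<notin> \<real>\<^sub>\<le>\<^sub>0" if "y \<notin> unit_cut" for y
  proof
    assume "1 - 1 / y\<^sup>2 \<in> \<real>\<^sub>\<le>\<^sub>0"
    then obtain t where t: "1 - 1 / y\<^sup>2 = of_real t" "t \<le> 0"
      by (auto elim!: nonpos_Reals_cases)
    have "1 / y\<^sup>2 = of_real (1 - t)"
      using t(1) by (simp add: algebra_simps)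
    hence "1 / (1 / y\<^sup>2) = 1 / of_real (1 - t)"
      by (rule arg_cong)
    hence "y\<^sup>2 = of_real (1 / (1 - t))"
      by simp
    also have "\<dots> = (of_real (sqrt (1 / (1 - t))))\<^sup>2"
      using t(2) by (simp flip: of_real_power)
    finally have "y = of_real (sqrt (1 / (1 - t))) \<or> y = - of_real (sqrt (1 / (1 - t)))"
      by (simp add: power2_eq_iff)
    moreover have "sqrt (1 / (1 - t)) \<le> 1" "sqrt (1 / (1 - t)) \<ge> 0"
      using t(2) by auto
    ultimately show False
      using that by (auto simp: cut_iff)
  qed
  moreover have "open (- unit_cut)"
    by auto
  ultimately show "(\<lambda>y. y * csqrt (1 - 1 / y\<^sup>2)) analytic_on (- unit_cut)"
    using nz by (auto simp: analytic_on_open intro!: holomorphic_intros)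
  show "(y * csqrt (1 - 1 / y\<^sup>2))\<^sup>2 = y\<^sup>2 - 1" if "y \<notin> unit_cut" for y
    using nz[OF that] by (simp add: power_mult_distrib field_simps)
  have "((\<lambda>y::complex. 1 - inverse y * inverse y) \<longlongrightarrow> 1 - 0 * 0) at_infinity"
    by (intro tendsto_intros tendsto_inverse_0)
  hence "((\<lambda>y::complex. csqrt (1 - inverse y * inverse y)) \<longlongrightarrow> csqrt 1) at_infinity"
    by (intro isCont_tendsto_compose[OF continuous_at_csqrt]) auto
  moreover have "\<forall>\<^sub>F y in at_infinity. csqrt (1 - inverse y * inverse y) = y * csqrt (1 - 1 / y\<^sup>2) / y"
    unfolding eventually_at_infinity
    by (intro exI[of _ 1]) (auto simp: field_simps power2_eq_square)
  ultimately show "((\<lambda>y. y * csqrt (1 - 1 / y\<^sup>2) / y) \<longlongrightarrow> 1) at_infinity"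
    using Lim_transform_eventually by fastforce
qed

lemma is_sqrt_branch_unique:
  assumes "is_sqrt_branch r" "is_sqrt_branch s" "y \<notin> unit_cut"
  shows "r y = s y"
proof -
  define q where "q = (\<lambda>z. r z / s z)"
  have sq: "(r z)\<^sup>2 = z\<^sup>2 - 1" "(s z)\<^sup>2 = z\<^sup>2 - 1" if "z \<notin> unit_cut" for z
    using assms that by (auto simp: is_sqrt_branch_def)
  have nz: "z\<^sup>2 - 1 \<noteq> 0" if "z \<notin> unit_cut" for z
    using that by (auto simp: cut_iff power2_eq_1_iff)
  have snz: "s z \<noteq> 0" if "z \<notin> unit_cut" for z
    using sq(2)[OF that] nz[OF that] by auto
  have "r holomorphic_on (- unit_cut)" "s holomorphic_on (- unit_cut)"
    using assms by (auto simp: is_sqrt_branch_def analytic_imp_holomorphic)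
  hence cont: "continuous_on (- unit_cut) q"
    unfolding q_def using snz by (intro continuous_intros holomorphic_on_imp_continuous_on) auto
  have pm: "q z \<in> {1, -1}" if "z \<notin> unit_cut" for z
  proof -
    have "(q z)\<^sup>2 = 1"
      using sq[OF that] nz[OF that] by (simp add: q_def power_divide)
    thus ?thesis by (simp add: power2_eq_1_iff)
  qed
  have "connected (- unit_cut)"
    by (intro connected_complement_bounded_convex) (auto simp: bounded_closed_segment)
  moreover have "finite (q ` (- unit_cut))"
    by (rule finite_subset[of _ "{1, -1}"]) (use pm in auto)
  ultimately have "q constant_on (- unit_cut)"
    using cont continuous_finite_range_constant by blast
  then obtain c where c: "\<And>z. z \<notin> unit_cut \<Longrightarrow> q z = c"
    by (auto simp: constant_on_def)
  have "((\<lambda>z. (r z / z) / (s z / z)) \<longlongrightarrow> 1 / 1) at_infinity"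
    using assms by (intro tendsto_divide) (auto simp: is_sqrt_branch_def)
  moreover have "\<forall>\<^sub>F z in at_infinity. (r z / z) / (s z / z) = c"
    unfolding eventually_at_infinity
  proof (intro exI[of _ 2] allI impI)
    fix z :: complex assume z: "2 \<le> norm z"
    have "z \<notin> unit_cut"
      using z abs_Re_le_cmod[of z] by (auto simp: cut_iff cmod_eq_Re)
    moreover have "z \<noteq> 0" using z by auto
    ultimately show "(r z / z) / (s z / z) = c"
      using c[of z] snz[of z] by (simp add: q_def)
  qed
  ultimately have "((\<lambda>_::complex. c) \<longlongrightarrow> 1) at_infinity"
    using Lim_transform_eventually by fastforce
  hence "c = 1"
    by (intro tendsto_unique[OF trivial_limit_at_infinity tendsto_const])
  thus ?thesis
    using c[OF assms(3)] snz[OF assms(3)] by (simp add: q_def)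
qed

end

theory Submission imports Defs begin

text \<open>
  Write \<open>P(y) = \<pi>\<^sub>n(\<surd>(2n) y)\<close> and \<open>w = P'/(n P)\<close>. Hermite's differential equation for \<open>P\<close>
  is the Riccati equation \<open>w\<^sup>2 - 4 y w + 4 = -w'/n\<close>. If \<open>w\<close> stays bounded off the cut
  \<open>[-1,1]\<close> as \<open>n\<close> grows, then Cauchy's estimate bounds \<open>w'\<close> too, the right-hand side is
  \<open>O(1/n)\<close>, and \<open>w\<close> must be close to one of the two roots \<open>2 (y \<plusminus> \<surd>(y\<^sup>2 - 1))\<close> of the quadratic
  on the left. This is a WKB argument that replaces contour integrals by algebra, and it is
  uniform in \<open>y\<close> because every estimate uses the distance to the cut only.

  Two properties of \<open>w\<close> are needed, and both follow from the three-term recurrence by induction,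
  without any information on the zeros: a bound \<open>w = O(1/|y|)\<close> (\<open>resolvent_decay\<close>), and a
  quantitative form of the fact that \<open>w\<close> stays away from the wrong root \<open>2 (y + \<surd>(y\<^sup>2 - 1))\<close>
  (\<open>resolvent_gap\<close>). For \<open>|y| \<ge> 1\<close> both come from the growth of \<open>\<pi>\<^sub>k\<close> in \<open>k\<close>; for \<open>|y| < 1\<close>
  they come from the sign of \<open>Im w\<close>, the recurrence being a continued fraction that maps each open
  half-plane into itself.

  The error \<open>e = w - 2 (y - \<surd>(y\<^sup>2 - 1))\<close> is then \<open>O(1/(n |y|\<^sup>2))\<close> together with its derivative
  (\<open>resolvent_error_decay\<close>). Inserting this into the Riccati equation once more gives the next
  term of \<open>w\<close>, which is the logarithmic derivative of the algebraic factor
  \<open>((y + \<surd>(y\<^sup>2 - 1)) / (2 \<surd>(y\<^sup>2 - 1)))\<close> to the power \<open>1/2\<close>. Hence the quotient of the two sides of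
  the asymptotic formula has a logarithmic derivative of size \<open>O(1/(n |y|\<^sup>2))\<close>
  (\<open>ratio_deriv\<close>, \<open>log_deriv_error_decay\<close>). Each ray \<open>{t y | t \<ge> 1}\<close> keeps its distance from the
  cut, and the quotient tends to \<open>1\<close> at infinity (\<open>ratio_tendsto_at_infinity\<close>). Integrating inwards along the ray shows that the quotient is
  \<open>1 + O(1/n)\<close> at \<open>y\<close> itself.
\<close>

section \<open>Hermite polynomials off the real oscillation interval\<close>

lemma pderiv_monic_hermite_Suc:
  "pderiv (monic_hermite (Suc n)) = smult (of_nat (Suc n)) (monic_hermite n)"
proof (induction n rule: monic_hermite.induct)
  case (3 n)
  have "pderiv (monic_hermite (Suc (Suc (Suc n)))) =
      monic_hermite (Suc (Suc n)) + [:0, 1:] * pderiv (monic_hermite (Suc (Suc n)))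
        - smult (of_nat (Suc (Suc n)) / 2) (pderiv (monic_hermite (Suc n)))"
    by (simp only: monic_hermite.simps(3)[of "Suc n"] pderiv_diff pderiv_mult pderiv_smult)
       (simp add: pderiv_pCons)
  also have "\<dots> = monic_hermite (Suc (Suc n)) + smult (of_nat (Suc (Suc n)))
      ([:0, 1:] * monic_hermite (Suc n) - smult (of_nat (Suc n) / 2) (monic_hermite n))"
    by (simp only: 3 smult_diff_right) (simp add: mult.commute)
  also have "\<dots> = smult (of_nat (Suc (Suc (Suc n)))) (monic_hermite (Suc (Suc n)))"
    by (simp only: monic_hermite.simps(3)[symmetric] of_nat_Suc[of "Suc (Suc n)"]
        smult_add_left smult_1_left)
  finally show ?case .
qed (simp_all add: pderiv_pCons pderiv_diff one_pCons)

lemma poly_pderiv_monic_hermite: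
  "poly (pderiv (monic_hermite n)) x = 2 * (x * poly (monic_hermite n) x - poly (monic_hermite (Suc n)) x)"
proof (cases n)
  case (Suc m)
  show ?thesis
    unfolding Suc pderiv_monic_hermite_Suc by (simp add: field_simps)
qed simp

lemma monic_hermite_leading_power: "((\<lambda>x. poly (monic_hermite n) x / x ^ n) \<longlongrightarrow> 1) at_infinity"
proof (induction n rule: monic_hermite.induct)
  case 2
  have "((\<lambda>_. 1) \<longlongrightarrow> (1::complex)) at_infinity" by simp
  then show ?case
    by (rule Lim_transform_eventually) (auto simp: eventually_at_infinity intro!: exI[of _ 1])
next
  case (3 n)
  have "((\<lambda>x. poly (monic_hermite (Suc n)) x / x ^ Suc n
      - of_nat (Suc n) / 2 * (poly (monic_hermite n) x / x ^ n) * (inverse x * inverse x))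
      \<longlongrightarrow> 1 - of_nat (Suc n) / 2 * 1 * (0 * 0)) at_infinity"
    by (intro tendsto_intros 3 tendsto_inverse_0)
  hence "((\<lambda>x. poly (monic_hermite (Suc n)) x / x ^ Suc n
      - of_nat (Suc n) / 2 * (poly (monic_hermite n) x / x ^ n) * (inverse x * inverse x))
      \<longlongrightarrow> 1) at_infinity"
    by simp
  then show ?case
  proof (rule Lim_transform_eventually)
    have *: "x \<noteq> 0 \<Longrightarrow> poly (monic_hermite (Suc n)) x / x ^ Suc n
      - of_nat (Suc n) / 2 * (poly (monic_hermite n) x / x ^ n) * (inverse x * inverse x)
       = poly (monic_hermite (Suc (Suc n))) x / x ^ Suc (Suc n)" for x
      by (simp add: field_simps)
    then show "\<forall>\<^sub>F x in at_infinity. poly (monic_hermite (Suc n)) x / x ^ Suc n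
      - of_nat (Suc n) / 2 * (poly (monic_hermite n) x / x ^ n) * (inverse x * inverse x)
       = poly (monic_hermite (Suc (Suc n))) x / x ^ Suc (Suc n)"
      unfolding eventually_at_infinity by (intro exI[of _ 1] allI impI *) auto
  qed
qed simp

text \<open>The recurrence loses at most half of \<open>|x|\<close> per step: if \<open>\<pi>\<^sub>k\<close> is at most \<open>2/|x|\<close> times
  \<open>\<pi>\<^sub>k\<^sub>+\<^sub>1\<close>, the subtracted term \<open>(k+1)/2 \<cdot> \<pi>\<^sub>k\<close> is at most \<open>(k+1)/|x| \<le> |x|/2\<close> times \<open>\<pi>\<^sub>k\<^sub>+\<^sub>1\<close>.\<close>

lemma monic_hermite_growth:
  assumes "x \<noteq> 0" "2 * real k \<le> (norm x)\<^sup>2"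
  shows "norm x / 2 * norm (poly (monic_hermite k) x) \<le> norm (poly (monic_hermite (Suc k)) x)"
  using assms(2)
proof (induction k)
  case (Suc k)
  define a b where "a = norm (poly (monic_hermite k) x)" and "b = norm (poly (monic_hermite (Suc k)) x)"
  have X: "norm x > 0" using assms(1) by simp
  have IH: "norm x / 2 * a \<le> b" using Suc by (simp add: a_def b_def)
  have "real (Suc k) / 2 * a = real (Suc k) / norm x * (norm x / 2 * a)"
    using X by (simp add: field_simps)
  also have "\<dots> \<le> real (Suc k) / norm x * b"
    using IH X by (intro mult_left_mono) auto
  also have "\<dots> \<le> norm x / 2 * b"
    using Suc.prems X by (intro mult_right_mono) (auto simp: b_def field_simps power2_eq_square)
  finally have "norm x * b - norm x / 2 * b \<le> norm x * b - real (Suc k) / 2 * a"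
    by linarith
  also have "\<dots> \<le> norm (x * poly (monic_hermite (Suc k)) x - of_nat (Suc k) / 2 * poly (monic_hermite k) x)"
    using norm_triangle_ineq2[of "x * poly (monic_hermite (Suc k)) x" "of_nat (Suc k) / 2 * poly (monic_hermite k) x"]
    by (simp add: a_def b_def norm_mult norm_divide del: of_nat_Suc)
  finally show ?case by (simp add: b_def)
qed simp

text \<open>For \<open>R\<^sub>k = \<pi>\<^sub>k\<^sub>+\<^sub>1/\<pi>\<^sub>k\<close> the recurrence is the continued fraction \<open>R\<^sub>k = x - (k/2)/R\<^sub>k\<^sub>-\<^sub>1\<close>. Since
  \<open>z \<mapsto> -1/z\<close> preserves the upper half-plane, \<open>Im R\<^sub>k \<ge> Im x\<close> there, and symmetrically below.
  Multiplying by \<open>|\<pi>\<^sub>k|\<^sup>2\<close> and by \<open>Im x\<close> avoids divisions and treats both half-planes at once.\<close>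

lemma monic_hermite_ratio_Im:
  "(Im x)\<^sup>2 * (norm (poly (monic_hermite k) x))\<^sup>2
     \<le> Im x * Im (poly (monic_hermite (Suc k)) x * cnj (poly (monic_hermite k) x))"
proof (induction k)
  case (Suc k)
  define a b where "a = poly (monic_hermite k) x" and "b = poly (monic_hermite (Suc k)) x"
  have "poly (monic_hermite (Suc (Suc k))) x = x * b - of_real (real (Suc k) / 2) * a"
    by (simp add: a_def b_def)
  hence "poly (monic_hermite (Suc (Suc k))) x * cnj b =
      x * of_real ((norm b)\<^sup>2) - of_real (real (Suc k) / 2) * (a * cnj b)"
    by (simp only: complex_norm_square) (simp add: algebra_simps)
  hence "Im (poly (monic_hermite (Suc (Suc k))) x * cnj b) =
      Im x * (norm b)\<^sup>2 - real (Suc k) / 2 * Im (a * cnj b)"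
    by (simp only: minus_complex.sel Im_complex_of_real Re_complex_of_real times_complex.sel)
  moreover have "Im (a * cnj b) = - Im (b * cnj a)" by simp
  ultimately have "Im x * Im (poly (monic_hermite (Suc (Suc k))) x * cnj b) =
      (Im x)\<^sup>2 * (norm b)\<^sup>2 + real (Suc k) / 2 * (Im x * Im (b * cnj a))"
    by (simp only: power2_eq_square) (simp add: algebra_simps)
  moreover have "0 \<le> (Im x)\<^sup>2 * (norm a)\<^sup>2" by simp
  hence "0 \<le> Im x * Im (b * cnj a)"
    using Suc.IH unfolding a_def b_def by linarith
  ultimately show ?case unfolding b_def by simp
qed (simp add: power2_eq_square)

lemma monic_hermite_nonzero_Im:
  assumes "Im x \<noteq> 0"
  shows "poly (monic_hermite k) x \<noteq> 0"
proof (induction k)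
  case (Suc k)
  show ?case
  proof
    assume "poly (monic_hermite (Suc k)) x = 0"
    with monic_hermite_ratio_Im[of x k] have "(Im x)\<^sup>2 * (norm (poly (monic_hermite k) x))\<^sup>2 \<le> 0" by simp
    with Suc assms show False by (simp add: mult_le_0_iff)
  qed
qed simp

lemma monic_hermite_nonzero_norm:
  assumes "x \<noteq> 0" "2 * real k \<le> (norm x)\<^sup>2"
  shows "poly (monic_hermite k) x \<noteq> 0"
  using assms(2)
proof (induction k)
  case (Suc k)
  have "0 < norm x / 2 * norm (poly (monic_hermite k) x)" using Suc assms(1) by simp
  also have "\<dots> \<le> norm (poly (monic_hermite (Suc k)) x)"
    using Suc.prems assms(1) by (intro monic_hermite_growth) auto
  finally show ?case by auto
qed simp

definition scaled_hermite :: "nat \<Rightarrow> complex \<Rightarrow> complex" where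
  "scaled_hermite n y = poly (monic_hermite n) (of_real (sqrt (2 * real n)) * y)"

text \<open>Since \<open>\<pi>\<^sub>n' = n \<pi>\<^sub>n\<^sub>-\<^sub>1\<close>, this is \<open>1/n\<close> times the logarithmic derivative of \<open>scaled_hermite n\<close>,
  that is, the Stieltjes transform of the normalised zero counting measure. The quotient form makes
  it accessible to the recurrence.\<close>

definition resolvent :: "nat \<Rightarrow> complex \<Rightarrow> complex" where
  "resolvent n y = of_real (sqrt (2 * real n)) *
     poly (monic_hermite (n - 1)) (of_real (sqrt (2 * real n)) * y) / scaled_hermite n y"

lemma notin_cut_cases:
  assumes "y \<notin> unit_cut"
  obtains "Im y \<noteq> 0" | "norm y \<ge> 1"
  using assms abs_Re_le_cmod[of y] by (force simp: cut_iff)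

lemma scaled_hermite_nonzero:
  assumes "y \<notin> unit_cut"
  shows "scaled_hermite n y \<noteq> 0"
proof (cases "n = 0")
  case False
  from assms show ?thesis
  proof (cases rule: notin_cut_cases)
    case 1
    then show ?thesis using False unfolding scaled_hermite_def by (intro monic_hermite_nonzero_Im) auto
  next
    case 2
    have "1 \<le> (norm y)\<^sup>2" using 2 by simp
    then have "2 * real n \<le> (norm (of_real (sqrt (2 * real n)) * y))\<^sup>2"
      using mult_left_mono[of 1 "(norm y)\<^sup>2" "2 * real n"] by (simp add: norm_mult power_mult_distrib)
    then show ?thesis using False 2 unfolding scaled_hermite_def
      by (intro monic_hermite_nonzero_norm) auto
  qed
qed (simp add: scaled_hermite_def)

lemma scaled_hermite_deriv:
  assumes "n > 0" "y \<notin> unit_cut"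
  shows "(scaled_hermite n has_field_derivative
            of_nat n * resolvent n y * scaled_hermite n y) (at y)"
proof -
  obtain m where m: "n = Suc m" using assms(1) gr0_implies_Suc by blast
  have "((\<lambda>y. poly (monic_hermite n) (of_real (sqrt (2 * real n)) * y)) has_field_derivative
      poly (pderiv (monic_hermite n)) (of_real (sqrt (2 * real n)) * y) * of_real (sqrt (2 * real n))) (at y)"
    by (rule DERIV_chain'[OF _ poly_DERIV]) (auto intro!: derivative_eq_intros)
  moreover have "poly (pderiv (monic_hermite n)) (of_real (sqrt (2 * real n)) * y) * of_real (sqrt (2 * real n))
      = of_nat n * resolvent n y * scaled_hermite n y"
    using scaled_hermite_nonzero[OF assms(2), of n]
    unfolding m pderiv_monic_hermite_Suc by (simp add: resolvent_def)
  ultimately show ?thesis by (simp add: scaled_hermite_def[abs_def])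
qed

text \<open>This is Hermite's differential equation \<open>\<pi>\<^sub>n'' - 2x \<pi>\<^sub>n' + 2n \<pi>\<^sub>n = 0\<close> after the substitution
  \<open>\<pi>\<^sub>n' = n w \<pi>\<^sub>n / \<surd>(2n)\<close>; it follows directly from the two derivative formulas for \<open>\<pi>\<^sub>n\<close>.\<close>

lemma resolvent_riccati:
  assumes "n > 0" "y \<notin> unit_cut"
  shows "(resolvent n has_field_derivative
            - of_nat n * ((resolvent n y)\<^sup>2 - 4 * y * resolvent n y + 4)) (at y)"
proof -
  obtain m where m: "n = Suc m" using assms(1) gr0_implies_Suc by blast
  define c where "c = complex_of_real (sqrt (2 * real n))"
  define a b where "a = scaled_hermite n y" and "b = poly (monic_hermite m) (c * y)"
  have nz: "a \<noteq> 0" using scaled_hermite_nonzero[OF assms(2)] by (simp add: a_def)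
  have c2: "c * c = 2 * of_nat n"
    unfolding c_def of_real_mult[symmetric] by simp
  have w: "resolvent n y = c * b / a" by (simp add: resolvent_def a_def b_def c_def m)
  have "((\<lambda>y. poly (monic_hermite m) (c * y)) has_field_derivative
      poly (pderiv (monic_hermite m)) (c * y) * c) (at y)"
    by (rule DERIV_chain'[OF _ poly_DERIV]) (auto intro!: derivative_eq_intros)
  moreover have "poly (pderiv (monic_hermite m)) (c * y) = 2 * (c * y * b - a)"
    unfolding poly_pderiv_monic_hermite by (simp add: a_def b_def scaled_hermite_def m c_def)
  ultimately have "((\<lambda>y. c * poly (monic_hermite m) (c * y) / scaled_hermite n y) has_field_derivative
      (c * (2 * (c * y * b - a) * c) * a - c * b * (of_nat n * (c * b / a) * a)) / (a * a)) (at y)"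
    using scaled_hermite_deriv[OF assms] scaled_hermite_nonzero[OF assms(2), of n]
    unfolding w b_def a_def by (auto intro!: derivative_eq_intros)
  moreover have "(c * (2 * (c * y * b - a) * c) * a - c * b * (of_nat n * (c * b / a) * a)) / (a * a)
     = 2 * (c * c) * (y * (c * b / a) - 1) - of_nat n * (c * b / a)\<^sup>2"
    using nz by (simp add: field_simps power2_eq_square)
  moreover have "\<dots> = - of_nat n * ((resolvent n y)\<^sup>2 - 4 * y * resolvent n y + 4)"
    unfolding c2 w by (simp add: algebra_simps)
  moreover have "resolvent n = (\<lambda>y. c * poly (monic_hermite m) (c * y) / scaled_hermite n y)"
    by (simp add: resolvent_def[abs_def] c_def m)
  ultimately show ?thesis by simp
qed

lemma resolvent_bound_norm:
  assumes "norm y \<ge> 1"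
  shows "norm (resolvent n y) \<le> 2 / norm y"
proof (cases n)
  case (Suc m)
  define c where "c = sqrt (2 * real n)"
  have c: "c > 0" "c\<^sup>2 = 2 * real n" by (auto simp: c_def Suc)
  have sh: "scaled_hermite n y = poly (monic_hermite (Suc m)) (of_real c * y)"
    by (simp add: scaled_hermite_def c_def Suc)
  have "1 \<le> (norm y)\<^sup>2" using assms by simp
  then have *: "2 * real n \<le> (norm (of_real c * y))\<^sup>2"
    using mult_left_mono[of 1 "(norm y)\<^sup>2" "2 * real n"] c by (simp add: norm_mult power_mult_distrib)
  have "norm (of_real c * y) / 2 * norm (poly (monic_hermite m) (of_real c * y)) \<le> norm (scaled_hermite n y)"
    unfolding sh
    by (rule monic_hermite_growth) (use c assms * Suc in auto)
  moreover have "scaled_hermite n y \<noteq> 0"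
    unfolding sh
    by (rule monic_hermite_nonzero_norm) (use c assms * Suc in auto)
  moreover have "norm (resolvent n y) = c * norm (poly (monic_hermite m) (of_real c * y)) / norm (scaled_hermite n y)"
    using c by (simp add: resolvent_def Suc norm_mult norm_divide c_def)
  moreover from calculation have "norm y * (c * norm (poly (monic_hermite m) (of_real c * y)) / norm (scaled_hermite n y)) \<le> 2"
    using c by (simp add: norm_mult field_simps)
  ultimately have "norm y * norm (resolvent n y) \<le> 2" by simp
  moreover have "0 < norm y" using assms by linarith
  ultimately show ?thesis by (simp add: pos_le_divide_eq mult.commute)
qed (simp add: resolvent_def)

lemma resolvent_Im:
  assumes "n > 0" "Im y \<noteq> 0"
  shows "Im y * Im (resolvent n y) \<le> 0" "norm (resolvent n y) \<le> 1 / \<bar>Im y\<bar>"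
proof -
  obtain m where m: "n = Suc m" using assms(1) gr0_implies_Suc by blast
  define c where "c = sqrt (2 * real n)"
  have c: "c > 0" by (auto simp: c_def m)
  define a b where "a = scaled_hermite n y" and "b = poly (monic_hermite m) (of_real c * y)"
  have w: "resolvent n y = of_real c * (b / a)" by (simp add: resolvent_def a_def b_def c_def m)
  have a: "a \<noteq> 0" using assms c unfolding a_def scaled_hermite_def c_def[symmetric]
    by (intro monic_hermite_nonzero_Im) auto
  have "(c * Im y)\<^sup>2 * (norm b)\<^sup>2 \<le> c * Im y * Im (a * cnj b)"
    using monic_hermite_ratio_Im[of "of_real c * y" m] by (simp add: a_def b_def scaled_hermite_def m c_def)
  then have "c * (c * (Im y)\<^sup>2 * (norm b)\<^sup>2) \<le> c * (Im y * Im (a * cnj b))"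
    by (simp only: power2_eq_square mult_ac)
  then have 1: "c * (Im y)\<^sup>2 * (norm b)\<^sup>2 \<le> Im y * Im (a * cnj b)"
    using c mult_le_cancel_left_pos by blast
  have "Im (b / a) = - Im (a * cnj b) / (norm a)\<^sup>2"
    by (simp add: complex_div_cnj[of b a] Im_divide_of_real flip: of_real_power)
  moreover have "Im (resolvent n y) = c * Im (b / a)"
    unfolding w by (simp only: times_complex.sel Re_complex_of_real Im_complex_of_real)
  ultimately have "Im y * Im (resolvent n y) = - (c * (Im y * Im (a * cnj b)) / (norm a)\<^sup>2)"
    by (simp only: times_divide_eq_right mult_minus_right minus_divide_left mult_ac)
  moreover have "0 \<le> c * (Im y)\<^sup>2 * (norm b)\<^sup>2" using c by simp
  then have "0 \<le> Im y * Im (a * cnj b)" using 1 by linarith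
  then have "0 \<le> c * (Im y * Im (a * cnj b)) / (norm a)\<^sup>2" using c
    by (intro divide_nonneg_nonneg mult_nonneg_nonneg[of c]) auto
  ultimately show "Im y * Im (resolvent n y) \<le> 0" by simp
  have "c * (Im y)\<^sup>2 * (norm b)\<^sup>2 \<le> \<bar>Im y\<bar> * (norm a * norm b)"
  proof -
    have "Im y * Im (a * cnj b) \<le> \<bar>Im y\<bar> * \<bar>Im (a * cnj b)\<bar>"
      by (metis abs_ge_self abs_mult)
    also have "\<dots> \<le> \<bar>Im y\<bar> * norm (a * cnj b)"
      by (intro mult_left_mono abs_Im_le_cmod) auto
    finally show ?thesis using 1 by (simp add: norm_mult)
  qed
  then have "(\<bar>Im y\<bar> * norm b) * (c * \<bar>Im y\<bar> * norm b) \<le> (\<bar>Im y\<bar> * norm b) * norm a"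
    by (simp add: power2_eq_square algebra_simps)
  then have "c * \<bar>Im y\<bar> * norm b \<le> norm a"
    using assms by (cases "b = 0") (auto simp: mult_le_cancel_left)
  then show "norm (resolvent n y) \<le> 1 / \<bar>Im y\<bar>"
    using c a assms by (simp add: w norm_mult norm_divide field_simps)
qed


section \<open>Distance to the cut\<close>

lemma notin_cut_of_infdist: "\<lbrakk>\<eta> > 0; infdist y unit_cut \<ge> \<eta>\<rbrakk> \<Longrightarrow> y \<notin> unit_cut"
  using infdist_zero[of y unit_cut] by fastforce

lemma norm_ge_infdist_cut: "infdist y unit_cut \<le> norm y"
  using infdist_le[of 0 unit_cut y] by (simp add: cut_iff)

text \<open>Scaling a point by \<open>t \<ge> 1\<close> is, up to the factor \<open>t\<close> in the distances, shrinking the cut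
  to \<open>[-1/t,1/t]\<close>. This keeps the rays used for the final integration away from the cut.\<close>

lemma infdist_cut_scale:
  assumes "t \<ge> 1"
  shows "infdist y unit_cut \<le> infdist (of_real t * y) unit_cut"
proof -
  have "infdist y unit_cut \<le> dist (of_real t * y) a" if a: "a \<in> unit_cut" for a
  proof -
    have "a / of_real t \<in> unit_cut"
      using a assms by (auto simp: cut_iff Re_divide_of_real Im_divide_of_real)
    then have "infdist y unit_cut \<le> dist y (a / of_real t)" by (rule infdist_le)
    also have "\<dots> \<le> t * dist y (a / of_real t)"
      using assms mult_right_mono[of 1 t "dist y (a / of_real t)"] by simp
    also have "\<dots> = norm (of_real t * (y - a / of_real t))"
      using assms by (simp add: norm_mult dist_norm)
    also have "of_real t * (y - a / of_real t) = of_real t * y - a"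
      using assms by (simp add: field_simps)
    finally show ?thesis by (simp add: dist_norm)
  qed
  then show ?thesis
    by (subst (2) infdist_notempty) (auto intro!: cINF_greatest)
qed

text \<open>The real part of such a point lies on the cut. This turns distance from the cut
  into distance from the real axis in the region where the growth lemma does not apply.\<close>

lemma abs_Im_ge_infdist_cut:
  assumes "norm y < 1"
  shows "infdist y unit_cut \<le> \<bar>Im y\<bar>"
proof -
  have "of_real (Re y) \<in> unit_cut"
    using abs_Re_le_cmod[of y] assms by (auto simp: cut_iff)
  then have "infdist y unit_cut \<le> dist y (of_real (Re y))" by (rule infdist_le)
  also have "\<dots> = \<bar>Im y\<bar>" by (simp add: dist_norm cmod_eq_Im)
  finally show ?thesis .
qed

section \<open>Decay of the resolvent and of derivatives\<close>

lemma resolvent_holomorphic: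
  assumes "n > 0"
  shows "resolvent n holomorphic_on - unit_cut"
proof -
  have "open (- unit_cut)" by auto
  then show ?thesis using resolvent_riccati[OF assms] by (auto simp: holomorphic_on_open)
qed

text \<open>Inside the unit disc the bound comes from the half-plane estimate, outside from the growth of the
  polynomials. The rate \<open>1/|y|\<close> is what later makes the errors integrable along unbounded rays.\<close>

lemma resolvent_decay:
  assumes "n > 0" "\<eta> > 0" "\<eta> \<le> infdist y unit_cut"
  shows "norm (resolvent n y) \<le> (2 + 1 / \<eta>) / norm y"
proof (cases "norm y < 1")
  case True
  have Im: "\<eta> \<le> \<bar>Im y\<bar>" using abs_Im_ge_infdist_cut[OF True] assms by linarith
  have y0: "norm y > 0" using norm_ge_infdist_cut[of y] assms by linarith
  have "norm (resolvent n y) \<le> 1 / \<bar>Im y\<bar>" using Im assms by (intro resolvent_Im) auto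
  also have "\<dots> \<le> 1 / \<eta>" using Im assms by (intro divide_left_mono) auto
  also have "\<dots> \<le> (2 + 1 / \<eta>) / 1" by simp
  also have "\<dots> \<le> (2 + 1 / \<eta>) / norm y" using True y0 assms by (intro divide_left_mono) auto
  finally show ?thesis .
next
  case False
  then have "norm (resolvent n y) \<le> 2 / norm y" by (intro resolvent_bound_norm) auto
  also have "\<dots> \<le> (2 + 1 / \<eta>) / norm y" using assms by (intro divide_right_mono) auto
  finally show ?thesis .
qed

text \<open>Cauchy's estimate on a disc of radius \<open>\<eta>/2\<close>: on it the distance to the cut is at least \<open>\<eta>/2\<close>,
  and \<open>|z| \<ge> |y|/2\<close> because \<open>|y| \<ge> \<eta>\<close> (the cut contains \<open>0\<close>), so power decay survives.\<close>

lemma deriv_decay: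
  assumes holo: "f holomorphic_on - unit_cut" and "\<eta> > 0" "K \<ge> 0"
    and bound: "\<And>z. \<eta> / 2 \<le> infdist z unit_cut \<Longrightarrow> norm (f z) \<le> K / norm z ^ p"
    and dist: "\<eta> \<le> infdist y unit_cut"
  shows "norm (deriv f y) \<le> 2 ^ (p + 1) * K / \<eta> / norm y ^ p"
proof -
  have y1: "norm y \<ge> \<eta>" using norm_ge_infdist_cut[of y] dist by linarith
  have near: "\<eta> / 2 \<le> infdist z unit_cut \<and> norm y / 2 \<le> norm z" if "dist y z \<le> \<eta> / 2" for z
  proof
    show "\<eta> / 2 \<le> infdist z unit_cut" using infdist_triangle[of y unit_cut z] dist that by linarith
    have "norm y \<le> norm z + dist y z" using norm_triangle_sub[of y z] by (simp add: dist_norm)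
    then show "norm y / 2 \<le> norm z" using that y1 by linarith
  qed
  have sub: "cball y (\<eta> / 2) \<subseteq> - unit_cut"
    using near notin_cut_of_infdist[of "\<eta> / 2"] \<open>\<eta> > 0\<close> by (auto simp: mem_cball)
  have "norm ((deriv ^^ 1) f y) \<le> fact 1 * (2 ^ p * K / norm y ^ p) / (\<eta> / 2) ^ 1"
  proof (rule Cauchy_inequality)
    show "f holomorphic_on ball y (\<eta> / 2)"
      using holo sub ball_subset_cball by (meson holomorphic_on_subset order.trans)
    show "continuous_on (cball y (\<eta> / 2)) f"
      using holo sub holomorphic_on_imp_continuous_on holomorphic_on_subset by blast
    fix z assume "norm (y - z) = \<eta> / 2"
    then have z: "\<eta> / 2 \<le> infdist z unit_cut" "norm y / 2 \<le> norm z"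
      using near[of z] by (auto simp: dist_norm)
    have "norm (f z) \<le> K / norm z ^ p" by (rule bound[OF z(1)])
    also have "\<dots> \<le> K / (norm y / 2) ^ p"
      using z y1 \<open>\<eta> > 0\<close> \<open>K \<ge> 0\<close>
      by (intro divide_left_mono power_mono mult_pos_pos zero_less_power) auto
    finally show "norm (f z) \<le> 2 ^ p * K / norm y ^ p" by (simp add: power_divide mult_ac)
  qed (use \<open>\<eta> > 0\<close> in auto)
  then show ?thesis by (simp add: mult_ac)
qed

section \<open>Integration from infinity\<close>

text \<open>If \<open>S\<close> is the supremum of \<open>|G|\<close>, integrating the derivative bound from \<open>t\<close> to infinity gives
  \<open>|1 - G t| \<le> a S\<close>. Hence \<open>S \<le> 1 + a S\<close>, so \<open>S \<le> 2\<close> as \<open>a \<le> 1/2\<close>, and the estimate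
  at \<open>t = 1\<close> follows. No logarithm of \<open>G\<close> has to be chosen.\<close>

lemma norm_start_minus_limit_le:
  fixes G :: "real \<Rightarrow> complex"
  assumes deriv: "\<And>t. t \<ge> 1 \<Longrightarrow> (G has_vector_derivative G' t) (at t)"
    and bound: "\<And>t. t \<ge> 1 \<Longrightarrow> norm (G' t) \<le> a / t\<^sup>2 * norm (G t)"
    and lim: "(G \<longlongrightarrow> 1) at_top" and a: "0 \<le> a" "a \<le> 1 / 2"
  shows "norm (G 1 - 1) \<le> 2 * a"
proof -
  have cont: "continuous_on {1..} G"
    using deriv by (intro continuous_at_imp_continuous_on) (auto intro: has_vector_derivative_continuous)
  have "eventually (\<lambda>t. dist (G t) 1 < 1) at_top" by (rule tendstoD[OF lim]) simp
  then obtain T where T: "\<And>t. t \<ge> T \<Longrightarrow> dist (G t) 1 < 1" by (auto simp: eventually_at_top_linorder)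
  have "bounded (G ` {1..max 1 T})"
    by (intro compact_imp_bounded compact_continuous_image continuous_on_subset[OF cont]) auto
  then obtain B where B: "\<And>t. t \<in> {1..max 1 T} \<Longrightarrow> norm (G t) \<le> B"
    unfolding bounded_iff by blast
  have "norm (G t) \<le> max B 2" if "t \<ge> 1" for t
  proof (cases "t \<le> T")
    case True
    then show ?thesis using B[of t] that by auto
  next
    case False
    then have "dist (G t) 1 < 1" using T by simp
    then show ?thesis using norm_triangle_sub[of "G t" 1] by (simp add: dist_norm)
  qed
  then have bdd: "bdd_above ((\<lambda>t. norm (G t)) ` {1..})" by (auto intro!: bdd_aboveI2)
  define S where "S = (SUP t\<in>{1..}. norm (G t))"
  have S: "norm (G t) \<le> S" if "t \<ge> 1" for t
    unfolding S_def using that by (intro cSUP_upper bdd) auto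
  have S0: "S \<ge> 0" using S[of 1] norm_ge_zero[of "G 1"] by linarith
  have est: "norm (1 - G t) \<le> a * S" if t: "t \<ge> 1" for t
  proof (rule Lim_norm_ubound)
    show "((\<lambda>u. G u - G t) \<longlongrightarrow> 1 - G t) at_top" by (intro tendsto_intros lim)
    show "eventually (\<lambda>u. norm (G u - G t) \<le> a * S) at_top"
      using eventually_gt_at_top[of t]
    proof eventually_elim
      case (elim u)
      have "norm (G u - G t) \<le> - (a * S) / u - (- (a * S) / t)"
      proof (rule differentiable_bound_general[OF elim])
        show "continuous_on {t..u} G" using t by (intro continuous_on_subset[OF cont]) auto
        show "continuous_on {t..u} (\<lambda>u. - (a * S) / u)" using t by (intro continuous_intros) auto
        fix x assume x: "t < x" "x < u"
        show "(G has_vector_derivative G' x) (at x)" using x t by (intro deriv) auto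
        show "((\<lambda>u. - (a * S) / u) has_vector_derivative a * S / x\<^sup>2) (at x)"
          unfolding has_real_derivative_iff_has_vector_derivative[symmetric]
          using x t by (auto intro!: derivative_eq_intros simp: power2_eq_square)
        have "norm (G' x) \<le> a / x\<^sup>2 * norm (G x)" using x t by (intro bound) auto
        also have "\<dots> \<le> a / x\<^sup>2 * S" using x t a by (intro mult_left_mono S) auto
        finally show "norm (G' x) \<le> a * S / x\<^sup>2" by simp
      qed
      also have "\<dots> \<le> a * S / t" using t elim a S0 by simp
      also have "\<dots> \<le> a * S / 1" using t a S0 by (intro divide_left_mono) auto
      finally show ?case by simp
    qed
  qed simp
  have "S \<le> 1 + a * S" unfolding S_def
  proof (rule cSUP_least)
    fix t :: real assume "t \<in> {1..}"
    then have "norm (1 - G t) \<le> a * S" by (intro est) auto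
    then show "norm (G t) \<le> 1 + a * (SUP t\<in>{1..}. norm (G t))"
      using norm_triangle_sub[of "G t" 1] by (simp add: norm_minus_commute S_def)
  qed auto
  moreover have "a * S \<le> 1 / 2 * S" using a S0 by (intro mult_right_mono)
  ultimately have "S \<le> 2" by simp
  then have "a * S \<le> a * 2" using a by (intro mult_left_mono)
  then show ?thesis using est[of 1] by (simp add: norm_minus_commute)
qed

text \<open>The constant \<open>(n/2e)\<close> to the power \<open>n/2\<close> compensates the limits \<open>y\<^sup>2 - y \<cdot> r y \<rightarrow> 1/2\<close> and \<open>(y + r y)/y \<rightarrow> 2\<close>
  at infinity, so that the leading term grows exactly like \<open>(\<surd>(2n) y)\<^sup>n\<close>.\<close>

lemma leading_constant:
  assumes "n > 0"
  shows "(real n / (2 * exp 1)) powr (real n / 2) * (exp (real n / 2) * 2 ^ n) = sqrt (2 * real n) ^ n"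
proof -
  define x where "x = real n / (2 * exp 1)"
  have x: "x > 0" using assms by (simp add: x_def)
  have "x powr (real n / 2) = (x powr (1 / 2)) powr real n" by (simp add: powr_powr)
  also have "\<dots> = sqrt x ^ n" using x by (simp add: powr_half_sqrt powr_realpow)
  finally have 1: "x powr (real n / 2) = sqrt x ^ n" .
  have 2: "exp (real n / 2) = exp (1 / 2) ^ n" by (simp flip: exp_of_nat_mult)
  have "sqrt x * (exp (1 / 2) * 2) = sqrt (2 * real n)"
  proof (rule real_sqrt_unique[symmetric])
    have "(exp (1 / 2 :: real))\<^sup>2 = exp 1" by (simp flip: exp_of_nat_mult)
    then show "(sqrt x * (exp (1 / 2) * 2))\<^sup>2 = 2 * real n"
      using x by (simp add: power_mult_distrib) (simp add: x_def)
  qed (use x in simp)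
  then show ?thesis unfolding x_def[symmetric] 1 2 power_mult_distrib[symmetric] by simp
qed

section \<open>The branch of the square root\<close>

context
  fixes r :: "complex \<Rightarrow> complex"
  assumes r: "is_sqrt_branch r"
begin

lemma branch_square: "y \<notin> unit_cut \<Longrightarrow> (r y)\<^sup>2 = y\<^sup>2 - 1"
  using r by (auto simp: is_sqrt_branch_def)

lemma branch_nonzero: "y \<notin> unit_cut \<Longrightarrow> r y \<noteq> 0"
  using branch_square[of y] by (auto simp: cut_iff power2_eq_1_iff)

lemma branch_conj: "y \<notin> unit_cut \<Longrightarrow> (y + r y) * (y - r y) = 1"
  using branch_square[of y] by (simp add: algebra_simps power2_eq_square)

lemma branch_sum_nonzero: "y \<notin> unit_cut \<Longrightarrow> y + r y \<noteq> 0"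
  using branch_conj[of y] by auto

lemma branch_holomorphic: "r holomorphic_on - unit_cut"
  using r by (auto simp: is_sqrt_branch_def analytic_imp_holomorphic)

text \<open>Explicitly \<open>r y = y \<cdot> csqrt (1 - 1/y\<^sup>2)\<close> with the principal root of non-negative real part, so
  \<open>r y\<close> never points away from \<open>y\<close>. This is how the choice of the branch enters the estimates.\<close>

lemma branch_half_plane:
  assumes "y \<notin> unit_cut"
  shows "Re (r y * cnj y) \<ge> 0"
proof -
  have "r y * cnj y = of_real ((norm y)\<^sup>2) * csqrt (1 - 1 / y\<^sup>2)"
    unfolding complex_norm_square
    by (simp add: is_sqrt_branch_unique[OF r is_sqrt_branch_csqrt assms])
  then have "Re (r y * cnj y) = (norm y)\<^sup>2 * Re (csqrt (1 - 1 / y\<^sup>2))"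
    by (simp only: times_complex.sel Re_complex_of_real Im_complex_of_real)
  then show ?thesis using csqrt_principal[of "1 - 1 / y\<^sup>2"]
    by (metis less_eq_real_def mult_nonneg_nonneg zero_le_power2)
qed

text \<open>The products \<open>a = Re (r y) Re y\<close> and \<open>b = Im y Im (r y)\<close> have \<open>a b \<ge> 0\<close> (compare imaginary
  parts in \<open>r\<^sup>2 = y\<^sup>2 - 1\<close>) and \<open>a + b \<ge> 0\<close>, so neither is negative.\<close>

lemma branch_Im:
  assumes "y \<notin> unit_cut"
  shows "Im y * Im (r y) \<ge> 0"
proof (rule ccontr)
  assume neg: "\<not> ?thesis"
  have "Im ((r y)\<^sup>2) = Im (y\<^sup>2)"
    using branch_square[OF assms] by simp
  then have "Re (r y) * Im (r y) = Re y * Im y"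
    by (simp add: power2_eq_square mult.commute)
  then have "(Re (r y) * Re y) * (Im y * Im (r y)) = (Re y * Im y)\<^sup>2"
    by (simp add: power2_eq_square mult_ac)
  moreover have "Re (r y) * Re y > 0"
    using branch_half_plane[OF assms] neg by (simp add: mult.commute)
  ultimately show False
    using neg mult_pos_neg[of "Re (r y) * Re y" "Im y * Im (r y)"]
      zero_le_power2[of "Re y * Im y"] by linarith
qed

lemma norm_branch_sum:
  "(norm (y + r y))\<^sup>2 = (norm y)\<^sup>2 + (norm (r y))\<^sup>2 + 2 * Re (r y * cnj y)"
  unfolding cmod_power2 by (simp add: power2_eq_square algebra_simps)

lemma norm_branch_diff:
  "(norm (y - r y))\<^sup>2 = (norm y)\<^sup>2 + (norm (r y))\<^sup>2 - 2 * Re (r y * cnj y)"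
  unfolding cmod_power2 by (simp add: power2_eq_square algebra_simps)

lemma norm_branch_sum_ge:
  assumes "y \<notin> unit_cut"
  shows "norm y \<le> norm (y + r y)"
proof (rule power2_le_imp_le)
  show "(norm y)\<^sup>2 \<le> (norm (y + r y))\<^sup>2"
    unfolding norm_branch_sum using branch_half_plane[OF assms] zero_le_power2[of "norm (r y)"]
    by linarith
qed simp

text \<open>The Joukowski picture: \<open>y = (p + 1/p)/2\<close> with \<open>p = y + r y\<close>, and \<open>y\<close> lies on the ellipse that is
  the image of the circle of radius \<open>\<rho> = |p| \<ge> 1\<close>. The point \<open>Re p/\<rho>\<close> of the cut is the
  image of \<open>p/\<rho>\<close>, and its distance from \<open>y\<close> is at most \<open>(\<rho> - 1/\<rho>)/2 \<le> \<rho> - 1\<close>.\<close>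

lemma norm_branch_sum_ge_infdist:
  assumes y: "y \<notin> unit_cut"
  shows "1 + infdist y unit_cut \<le> norm (y + r y)"
proof -
  define p where "p = y + r y"
  define \<rho> where "\<rho> = norm p"
  have p0: "p \<noteq> 0" using branch_sum_nonzero[OF y] by (simp add: p_def)
  then have \<rho>0: "\<rho> > 0" by (simp add: \<rho>_def)
  have "norm (y - r y) \<le> \<rho>"
    unfolding \<rho>_def p_def
  proof (rule power2_le_imp_le)
    show "(norm (y - r y))\<^sup>2 \<le> (norm (y + r y))\<^sup>2"
      unfolding norm_branch_sum norm_branch_diff using branch_half_plane[OF y] by linarith
  qed simp
  moreover have "\<rho> * norm (y - r y) = 1"
    using branch_conj[OF y] unfolding \<rho>_def p_def norm_mult[symmetric] by simp
  ultimately have "1 \<le> \<rho> * \<rho>"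
    using mult_left_mono[of "norm (y - r y)" \<rho> \<rho>] \<rho>0 by simp
  then have "1\<^sup>2 \<le> \<rho>\<^sup>2" by (simp add: power2_eq_square)
  then have \<rho>1: "1 \<le> \<rho>" by (rule power2_le_imp_le) (use \<rho>0 in simp)
  have inv: "y - r y = cnj p / of_real (\<rho>\<^sup>2)"
  proof -
    have "y - r y = 1 / p" using branch_conj[OF y] p0 by (simp add: p_def field_simps)
    also have "\<dots> = cnj p / (p * cnj p)" using p0 by simp
    finally show ?thesis unfolding \<rho>_def complex_norm_square .
  qed
  define a where "a = complex_of_real (Re p / \<rho>)"
  have "a \<in> unit_cut" using \<rho>0 abs_Re_le_cmod[of p] by (simp add: a_def cut_iff \<rho>_def)
  then have "infdist y unit_cut \<le> norm (y - a)" using infdist_le by (metis dist_norm)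
  also have "y - a = (p * of_real (1 - 1 / \<rho>) + cnj p * of_real (1 / \<rho>\<^sup>2 - 1 / \<rho>)) / 2"
  proof -
    have "2 * y = p + (y - r y)" by (simp add: p_def)
    then have "2 * y = p + cnj p / of_real (\<rho>\<^sup>2)" unfolding inv .
    moreover have "2 * a = (p + cnj p) / of_real \<rho>" by (simp add: a_def complex_add_cnj)
    ultimately have "2 * (y - a) = p * of_real (1 - 1 / \<rho>) + cnj p * of_real (1 / \<rho>\<^sup>2 - 1 / \<rho>)"
      using \<rho>0 by (simp add: algebra_simps add_divide_distrib)
    then show ?thesis by (simp add: mult.commute)
  qed
  also have "norm \<dots> \<le> (\<rho> * \<bar>1 - 1 / \<rho>\<bar> + \<rho> * \<bar>1 / \<rho>\<^sup>2 - 1 / \<rho>\<bar>) / 2"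
    using norm_triangle_ineq[of "p * of_real (1 - 1 / \<rho>)" "cnj p * of_real (1 / \<rho>\<^sup>2 - 1 / \<rho>)"]
    by (simp only: norm_divide norm_mult norm_of_real complex_mod_cnj \<rho>_def[symmetric]) simp
  also have "\<bar>1 - 1 / \<rho>\<bar> = 1 - 1 / \<rho>" using \<rho>1 by simp
  also have "\<bar>1 / \<rho>\<^sup>2 - 1 / \<rho>\<bar> = 1 / \<rho> - 1 / \<rho>\<^sup>2"
    using \<rho>1 \<rho>0 by (simp add: field_simps power2_eq_square)
  also have "(\<rho> * (1 - 1 / \<rho>) + \<rho> * (1 / \<rho> - 1 / \<rho>\<^sup>2)) / 2 = (\<rho> - 1 / \<rho>) / 2"
    using \<rho>0 by (simp add: field_simps power2_eq_square)
  also have "\<dots> \<le> \<rho> - 1"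
  proof -
    have "0 \<le> (\<rho> - 1)\<^sup>2 / \<rho>" using \<rho>0 by simp
    also have "\<dots> = \<rho> - 2 + 1 / \<rho>" using \<rho>0 by (simp add: field_simps power2_eq_square)
    finally show ?thesis by simp
  qed
  finally show ?thesis by (simp add: \<rho>_def p_def)
qed

lemma norm_branch_ge_infdist:
  assumes y: "y \<notin> unit_cut"
  shows "infdist y unit_cut \<le> norm (r y)"
proof (rule power2_le_imp_le)
  have "(infdist y unit_cut)\<^sup>2 \<le> norm (y - 1) * norm (y - (-1))"
    unfolding power2_eq_square
    using infdist_le[of 1 unit_cut y] infdist_le[of "-1" unit_cut y]
    by (intro mult_mono) (auto simp: dist_norm infdist_nonneg)
  also have "\<dots> = (norm (r y))\<^sup>2"
    unfolding norm_mult[symmetric] norm_power[symmetric] branch_square[OF y]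
    by (simp add: algebra_simps power2_eq_square)
  finally show "(infdist y unit_cut)\<^sup>2 \<le> (norm (r y))\<^sup>2" .
qed simp

lemma branch_deriv:
  assumes y: "y \<notin> unit_cut"
  shows "(r has_field_derivative y / r y) (at y)"
proof -
  have o: "open (- unit_cut)" by auto
  have d: "(r has_field_derivative deriv r y) (at y)"
    using holomorphic_derivI[OF branch_holomorphic o] y by simp
  have "((\<lambda>z. (r z)\<^sup>2) has_field_derivative 2 * r y * deriv r y) (at y)"
    by (rule derivative_eq_intros d refl)+ simp
  moreover have "((\<lambda>z. (r z)\<^sup>2) has_field_derivative 2 * y) (at y)"
  proof (rule has_field_derivative_transform_within_open[OF _ o])
    show "((\<lambda>z. z\<^sup>2 - 1) has_field_derivative 2 * y) (at y)"
      by (auto intro!: derivative_eq_intros)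
  qed (use y branch_square in auto)
  ultimately have "2 * r y * deriv r y = 2 * y" by (rule DERIV_unique)
  then have "deriv r y = y / r y" using branch_nonzero[OF y] by (simp add: field_simps)
  with d show ?thesis by simp
qed


section \<open>Locating the resolvent near a root of the quadratic\<close>

text \<open>Separation from the wrong root \<open>2 (y + r y)\<close>. For \<open>|y| < 1\<close>, the imaginary parts of \<open>y\<close> and \<open>r y\<close>
  agree in sign and that of the resolvent is opposite. For \<open>|y| \<ge> 1\<close>, the resolvent has modulus
  at most \<open>2\<close> whereas \<open>|y + r y| \<ge> 1 + \<eta>\<close>. Comparing \<open>|y + r y|\<close> with \<open>|y|\<close> gives the factor \<open>|y|\<close>.\<close>

lemma resolvent_gap:
  assumes "n > 0" "\<eta> > 0" "\<eta> \<le> infdist y unit_cut"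
  shows "2 * \<eta> / (1 + \<eta>) * norm y \<le> norm (2 * (y + r y) - resolvent n y)"
proof (cases "norm y < 1")
  case True
  have y: "y \<notin> unit_cut" using assms notin_cut_of_infdist by blast
  have Im: "\<eta> \<le> \<bar>Im y\<bar>" using abs_Im_ge_infdist_cut[OF True] assms by linarith
  then have "Im y \<noteq> 0" using assms by auto
  define D where "D = 2 * (y + r y) - resolvent n y"
  have "2 * (Im y)\<^sup>2 \<le> 2 * (Im y * Im y) + 2 * (Im y * Im (r y)) - Im y * Im (resolvent n y)"
    using branch_Im[OF y] resolvent_Im(1)[OF assms(1) \<open>Im y \<noteq> 0\<close>] by (simp add: power2_eq_square)
  also have "\<dots> = Im y * Im D" by (simp add: D_def algebra_simps)
  also have "\<dots> \<le> \<bar>Im y\<bar> * norm D"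
    using abs_ge_self[of "Im y * Im D"] mult_left_mono[OF abs_Im_le_cmod[of D] abs_ge_zero[of "Im y"]]
    by (simp only: abs_mult)
  finally have "\<bar>Im y\<bar> * (2 * \<bar>Im y\<bar>) \<le> \<bar>Im y\<bar> * norm D"
    by (simp add: power2_eq_square)
  then have "2 * \<bar>Im y\<bar> \<le> norm D" using \<open>Im y \<noteq> 0\<close> by (simp add: mult_le_cancel_left)
  moreover have "2 * \<eta> / (1 + \<eta>) * norm y \<le> 2 * \<eta> * 1"
    using assms True by (intro mult_mono) (auto simp: divide_le_eq)
  ultimately show ?thesis using Im unfolding D_def by linarith
next
  case False
  have y: "y \<notin> unit_cut" using assms notin_cut_of_infdist by blast
  define \<rho> where "\<rho> = norm (y + r y)"
  have "1 + \<eta> \<le> \<rho>" using norm_branch_sum_ge_infdist[OF y] assms by (simp add: \<rho>_def)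
  have "2 * \<eta> / (1 + \<eta>) * norm y \<le> 2 * \<eta> / (1 + \<eta>) * \<rho>"
    using assms norm_branch_sum_ge[OF y] by (intro mult_left_mono) (auto simp: \<rho>_def)
  also have "\<dots> \<le> 2 * \<rho> - 2"
    using \<open>1 + \<eta> \<le> \<rho>\<close> assms by (simp add: field_simps)
  also have "\<dots> \<le> 2 * \<rho> - norm (resolvent n y)"
  proof -
    have "norm (resolvent n y) \<le> 2 / norm y" using False by (intro resolvent_bound_norm) auto
    also have "\<dots> \<le> 2 / 1" using False by (intro divide_left_mono) auto
    finally show ?thesis by simp
  qed
  also have "\<dots> \<le> norm (2 * (y + r y) - resolvent n y)"
    using norm_triangle_ineq2[of "2 * (y + r y)" "resolvent n y"] by (simp only: norm_mult \<rho>_def) simp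
  finally show ?thesis .
qed

definition resolvent_error :: "nat \<Rightarrow> complex \<Rightarrow> complex" where
  "resolvent_error n y = resolvent n y - 2 * (y - r y)"

lemma resolvent_error_holomorphic:
  assumes "n > 0"
  shows "resolvent_error n holomorphic_on - unit_cut"
  unfolding resolvent_error_def[abs_def]
  using resolvent_holomorphic[OF assms] branch_holomorphic by (intro holomorphic_intros)

text \<open>The Riccati equation, factored over the two roots \<open>2 (y \<plusminus> r y)\<close>.\<close>

lemma resolvent_error_equation:
  assumes "n > 0" "y \<notin> unit_cut"
  shows "resolvent_error n y * (2 * (y + r y) - resolvent n y) = deriv (resolvent n) y / of_nat n"
proof -
  have "deriv (resolvent n) y = - of_nat n * ((resolvent n y)\<^sup>2 - 4 * y * resolvent n y + 4)"
    by (rule DERIV_imp_deriv[OF resolvent_riccati[OF assms]])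
  then have "deriv (resolvent n) y / of_nat n = 4 * (y\<^sup>2 - 1) - (resolvent n y - 2 * y)\<^sup>2"
    using assms(1) by (simp add: field_simps power2_eq_square)
  also have "\<dots> = resolvent_error n y * (2 * (y + r y) - resolvent n y)"
    unfolding branch_square[OF assms(2), symmetric] resolvent_error_def
    by (simp add: algebra_simps power2_eq_square)
  finally show ?thesis by simp
qed

text \<open>Divide the factored equation by its second factor, which is at least of order \<open>|y|\<close>; the derivative
  of the resolvent contributes another \<open>1/|y|\<close>, for a total of \<open>1/(n |y|\<^sup>2)\<close>.\<close>

lemma resolvent_error_decay:
  assumes "\<eta> > 0"
  shows "\<exists>C\<ge>0. \<forall>n>0. \<forall>y. \<eta> \<le> infdist y unit_cut \<longrightarrow> norm (resolvent_error n y) \<le> C / real n / norm y ^ 2"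
proof (intro exI conjI allI impI)
  define K where "K = 2 ^ (1 + 1) * (2 + 2 / \<eta>) / \<eta>"
  define c where "c = 2 * \<eta> / (1 + \<eta>)"
  have c: "c > 0" using assms by (simp add: c_def)
  show "K / c \<ge> 0" using assms c by (simp add: K_def)
  fix n :: nat and y assume n: "n > 0" and dist: "\<eta> \<le> infdist y unit_cut"
  have y: "y \<notin> unit_cut" using assms dist notin_cut_of_infdist by blast
  then have y0: "norm y > 0" by (auto simp: cut_iff)
  have "norm (deriv (resolvent n) y) \<le> 2 ^ (1 + 1) * (2 + 2 / \<eta>) / \<eta> / norm y ^ 1"
  proof (rule deriv_decay[OF resolvent_holomorphic[OF n] assms _ _ dist])
    fix z assume "\<eta> / 2 \<le> infdist z unit_cut"
    with resolvent_decay[of n "\<eta> / 2" z] n assms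
    show "norm (resolvent n z) \<le> (2 + 2 / \<eta>) / norm z ^ 1" by simp
  qed (use assms in auto)
  then have d: "norm (deriv (resolvent n) y) \<le> K / norm y" by (simp add: K_def)
  have "norm (resolvent_error n y) * (c * norm y) \<le>
        norm (resolvent_error n y) * norm (2 * (y + r y) - resolvent n y)"
    using resolvent_gap[OF n assms dist] by (intro mult_left_mono) (auto simp: c_def)
  also have "\<dots> = norm (deriv (resolvent n) y) / real n"
    unfolding norm_mult[symmetric] resolvent_error_equation[OF n y] by (simp add: norm_divide)
  also have "\<dots> \<le> K / norm y / real n" using d by (intro divide_right_mono) auto
  finally show "norm (resolvent_error n y) \<le> K / c / real n / norm y ^ 2"
    using c y0 n by (simp add: field_simps power2_eq_square)
qed

text \<open>With \<open>e\<close> the resolvent error, the Riccati equation reads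
  \<open>4 n e r - n e\<^sup>2 = 2 (1 - y/r) + e'\<close>. Solving for the linear occurrence of \<open>e\<close> gives
  \<open>n e = (r - y)/(2 r\<^sup>2) + (e' + n e\<^sup>2)/(4 r)\<close>. The first summand is the logarithmic derivative of the
  algebraic factor of the leading term, and the second, defined here, is what remains.\<close>

definition log_deriv_error :: "nat \<Rightarrow> complex \<Rightarrow> complex" where
  "log_deriv_error n y =
     (deriv (resolvent_error n) y + of_nat n * (resolvent_error n y)\<^sup>2) / (4 * r y)"

lemma log_deriv_error_decay:
  assumes "\<eta> > 0"
  shows "\<exists>C\<ge>0. \<forall>n>0. \<forall>y. \<eta> \<le> infdist y unit_cut \<longrightarrow> norm (log_deriv_error n y) \<le> C / real n / norm y ^ 2"
proof -
  \<comment> \<open>Half the distance, since the derivative of the error costs one more application of Cauchy's estimate\<close>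
  obtain C where C: "C \<ge> 0" and bound: "\<And>n y. n > 0 \<Longrightarrow> \<eta> / 2 \<le> infdist y unit_cut \<Longrightarrow>
      norm (resolvent_error n y) \<le> C / real n / norm y ^ 2"
    using resolvent_error_decay[of "\<eta> / 2"] assms by auto
  define K where "K = (2 ^ (2 + 1) * C / \<eta> + C\<^sup>2 / \<eta>\<^sup>2) / (4 * \<eta>)"
  have "norm (log_deriv_error n y) \<le> K / real n / norm y ^ 2"
    if n: "n > 0" and dist: "\<eta> \<le> infdist y unit_cut" for n y
  proof -
    have y: "y \<notin> unit_cut" using assms dist notin_cut_of_infdist by blast
    have y1: "norm y \<ge> \<eta>" using norm_ge_infdist_cut[of y] dist by linarith
    then have y0: "norm y > 0" using assms by linarith
    have r1: "norm (r y) \<ge> \<eta>" using norm_branch_ge_infdist[OF y] dist by linarith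
    have 1: "norm (deriv (resolvent_error n) y) \<le> 2 ^ (2 + 1) * (C / real n) / \<eta> / norm y ^ 2"
      by (rule deriv_decay[OF resolvent_error_holomorphic[OF n] assms _ bound[OF n] dist]) (use C in auto)
    have "norm (of_nat n * (resolvent_error n y)\<^sup>2) \<le> real n * (C / real n / norm y ^ 2)\<^sup>2"
      using bound[of n y] n dist assms by (simp add: norm_mult norm_power power_mono)
    also have "\<dots> = (C\<^sup>2 / (norm y)\<^sup>2) / real n / (norm y)\<^sup>2"
      using n y0 by (simp add: field_simps power2_eq_square)
    also have "\<dots> \<le> (C\<^sup>2 / \<eta>\<^sup>2) / real n / (norm y)\<^sup>2"
      using y1 assms by (intro divide_right_mono divide_left_mono power_mono mult_pos_pos) auto
    finally have "norm (deriv (resolvent_error n) y + of_nat n * (resolvent_error n y)\<^sup>2) \<le>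
        2 ^ (2 + 1) * (C / real n) / \<eta> / norm y ^ 2 + (C\<^sup>2 / \<eta>\<^sup>2) / real n / (norm y)\<^sup>2"
      using 1 by (intro norm_triangle_mono)
    also have "\<dots> = (2 ^ (2 + 1) * C / \<eta> + C\<^sup>2 / \<eta>\<^sup>2) / real n / norm y ^ 2"
      by (simp add: add_divide_distrib)
    finally have 2: "norm (deriv (resolvent_error n) y + of_nat n * (resolvent_error n y)\<^sup>2) \<le> \<dots>" .
    have "norm (log_deriv_error n y) \<le> (2 ^ (2 + 1) * C / \<eta> + C\<^sup>2 / \<eta>\<^sup>2) / real n / norm y ^ 2 / (4 * \<eta>)"
      unfolding log_deriv_error_def norm_divide
      by (rule frac_le) (use 2 r1 C assms in \<open>auto simp: norm_mult\<close>)
    then show ?thesis by (simp add: K_def mult_ac)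
  qed
  moreover have "K \<ge> 0" using C assms by (simp add: K_def)
  ultimately show ?thesis by blast
qed

section \<open>Comparison with the leading term\<close>

text \<open>The exponentiated logarithm is written as a power, which makes the function visibly holomorphic off
  the cut.\<close>

definition leading_term :: "nat \<Rightarrow> complex \<Rightarrow> complex" where
  "leading_term n y = of_real ((real n / (2 * exp 1)) powr (real n / 2)) *
     (exp (of_nat n * (y\<^sup>2 - y * r y)) * (y + r y) ^ n * ((y + r y) / (2 * r y)) powr (1 / 2))"

text \<open>The quotient is \<open>(1 + y / r y)/2\<close>, and \<open>y / r y\<close> has non-negative real part. Hence the argument of
  the outer square root avoids the branch cut of the principal power.\<close>

lemma branch_quotient_Re:
  assumes y: "y \<notin> unit_cut"
  shows "Re ((y + r y) / (2 * r y)) > 0"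
proof -
  have r0: "r y \<noteq> 0" by (rule branch_nonzero[OF y])
  then have q: "(y + r y) / (2 * r y) = (1 + y / r y) / 2" by (simp add: field_simps)
  have "Re (y / r y) \<ge> 0"
  proof -
    have "Re (y / r y) = Re (y * cnj (r y)) / (norm (r y))\<^sup>2"
      by (simp add: complex_div_cnj[of y "r y"] Re_divide_of_real flip: of_real_power)
    also have "Re (y * cnj (r y)) = Re (r y * cnj y)" by (simp add: mult.commute)
    finally show ?thesis using branch_half_plane[OF y] by (metis divide_nonneg_nonneg zero_le_power2)
  qed
  then show ?thesis unfolding q by simp
qed

lemma leading_term_nonzero:
  assumes "n > 0" "y \<notin> unit_cut"
  shows "leading_term n y \<noteq> 0"
  using branch_sum_nonzero[OF assms(2)] branch_nonzero[OF assms(2)] assms(1)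
  by (simp add: leading_term_def)

text \<open>The exponent contributes \<open>n (2 y - r - y\<^sup>2/r)\<close> and the power \<open>(y + r)\<^sup>n\<close> contributes \<open>n/r\<close>; since
  \<open>y\<^sup>2 - 1 = r\<^sup>2\<close> they add up to \<open>2 n (y - r)\<close>, that is, \<open>n\<close> times the selected root.\<close>

lemma leading_term_deriv:
  assumes n: "n > 0" and y: "y \<notin> unit_cut"
  shows "(leading_term n has_field_derivative
           (2 * of_nat n * (y - r y) + (r y - y) / (2 * (r y)\<^sup>2)) * leading_term n y) (at y)"
proof -
  define p where "p = y + r y"
  have r0: "r y \<noteq> 0" by (rule branch_nonzero[OF y])
  have p0: "p \<noteq> 0" unfolding p_def by (rule branch_sum_nonzero[OF y])
  have dp: "((\<lambda>y. y + r y) has_field_derivative p / r y) (at y)"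
    using r0 by (auto intro!: derivative_eq_intros branch_deriv[OF y] simp: p_def field_simps)
  have d1: "((\<lambda>y. exp (of_nat n * (y\<^sup>2 - y * r y))) has_field_derivative
      exp (of_nat n * (y\<^sup>2 - y * r y)) * (of_nat n * (2 * y - r y - y * (y / r y)))) (at y)"
    by (auto intro!: derivative_eq_intros branch_deriv[OF y] simp: algebra_simps)
  have d2: "((\<lambda>y. (y + r y) ^ n) has_field_derivative (of_nat n / r y) * p ^ n) (at y)"
  proof -
    have "((\<lambda>y. (y + r y) ^ n) has_field_derivative of_nat n * (p / r y * p ^ (n - 1))) (at y)"
      using DERIV_power[OF dp, of n] by (simp add: p_def)
    moreover have "p ^ n = p * p ^ (n - 1)" using n by (cases n) auto
    ultimately show ?thesis by simp
  qed
  define q where "q = (y + r y) / (2 * r y)"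
  have q0: "q \<noteq> 0" using p0 r0 by (simp add: q_def p_def)
  have q: "q \<notin> \<real>\<^sub>\<le>\<^sub>0"
    using branch_quotient_Re[OF y] complex_nonpos_Reals_iff[of q] unfolding q_def by linarith
  have dq: "((\<lambda>y. (y + r y) / (2 * r y)) has_field_derivative q * ((r y - y) / (r y)\<^sup>2)) (at y)"
  proof -
    have "((\<lambda>y. (y + r y) / (2 * r y)) has_field_derivative
        (p / r y * (2 * r y) - p * (2 * (y / r y))) / (2 * r y * (2 * r y))) (at y)"
      unfolding p_def by (rule DERIV_divide[OF dp[unfolded p_def] DERIV_cmult[OF branch_deriv[OF y]]]) (use r0 in simp)
    moreover have "(p / r y * (2 * r y) - p * (2 * (y / r y))) / (2 * r y * (2 * r y)) = q * ((r y - y) / (r y)\<^sup>2)"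
      using r0 by (simp add: q_def p_def[symmetric] field_simps power2_eq_square)
    ultimately show ?thesis by simp
  qed
  have d3: "((\<lambda>y. ((y + r y) / (2 * r y)) powr (1 / 2)) has_field_derivative
      ((r y - y) / (2 * (r y)\<^sup>2)) * q powr (1 / 2)) (at y)"
  proof -
    have "((\<lambda>y. ((y + r y) / (2 * r y)) powr (1 / 2)) has_field_derivative
        1 / 2 * q powr (1 / 2 - 1) * (q * ((r y - y) / (r y)\<^sup>2))) (at y)"
      using DERIV_chain2[OF has_field_derivative_powr[OF q, of "1 / 2", unfolded q_def] dq]
      unfolding q_def .
    moreover have "q powr (1 / 2 - 1) = q powr (1 / 2) / q"
      using q0 by (simp only: powr_diff) simp
    ultimately show ?thesis using q0 by (simp add: mult_ac)
  qed
  have sq: "2 * y - r y - y * (y / r y) + 1 / r y = 2 * (y - r y)"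
  proof -
    have "2 * y - r y - y * (y / r y) + 1 / r y = 2 * y - r y - (y\<^sup>2 - 1) / r y"
      by (simp add: diff_divide_distrib power2_eq_square)
    then show ?thesis unfolding branch_square[OF y, symmetric] using r0 by (simp add: power2_eq_square)
  qed
  define E P Q where "E = exp (of_nat n * (y\<^sup>2 - y * r y))" and "P = p ^ n" and "Q = q powr (1 / 2)"
  define K where "K = complex_of_real ((real n / (2 * exp 1)) powr (real n / 2))"
  have D: "(leading_term n has_field_derivative
      K * (((E * (of_nat n * (2 * y - r y - y * (y / r y)))) * P + (of_nat n / r y * P) * E) * Q
        + ((r y - y) / (2 * (r y)\<^sup>2) * Q) * (E * P))) (at y)"
    unfolding leading_term_def[abs_def] K_def[symmetric]
    using DERIV_cmult[OF DERIV_mult[OF DERIV_mult[OF d1 d2] d3], of K]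
    by (simp add: E_def P_def Q_def p_def q_def)
  have EQ: "K * (((E * (of_nat n * (2 * y - r y - y * (y / r y)))) * P + (of_nat n / r y * P) * E) * Q
        + ((r y - y) / (2 * (r y)\<^sup>2) * Q) * (E * P)) =
      (of_nat n * (2 * y - r y - y * (y / r y) + 1 / r y) + (r y - y) / (2 * (r y)\<^sup>2)) * (K * (E * P * Q))"
    by (simp add: algebra_simps)
  have LT: "leading_term n y = K * (E * P * Q)"
    by (simp add: leading_term_def K_def E_def P_def Q_def p_def q_def)
  show ?thesis using D unfolding EQ sq LT by (simp only: mult_ac)
qed

lemma ratio_deriv:
  assumes n: "n > 0" and y: "y \<notin> unit_cut"
  shows "((\<lambda>y. scaled_hermite n y / leading_term n y) has_field_derivative
           log_deriv_error n y * (scaled_hermite n y / leading_term n y)) (at y)"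
proof -
  define e w where "e = resolvent_error n y" and "w = resolvent n y"
  have r0: "r y \<noteq> 0" by (rule branch_nonzero[OF y])
  have "(resolvent n has_field_derivative deriv (resolvent n) y) (at y)"
    using holomorphic_derivI[OF resolvent_holomorphic[OF n], of y] y by (simp add: open_Compl)
  then have "(resolvent_error n has_field_derivative deriv (resolvent n) y - 2 * (1 - y / r y)) (at y)"
    unfolding resolvent_error_def[abs_def]
    by (auto intro!: derivative_eq_intros branch_deriv[OF y])
  then have "deriv (resolvent_error n) y = deriv (resolvent n) y - 2 * (1 - y / r y)"
    by (rule DERIV_imp_deriv)
  moreover have "deriv (resolvent n) y = of_nat n * (e * (4 * r y - e))"
    using resolvent_error_equation[OF n y] n by (simp add: e_def resolvent_error_def field_simps)
  ultimately have "log_deriv_error n y = (of_nat n * (e * (4 * r y - e)) - 2 * (1 - y / r y) + of_nat n * e\<^sup>2) / (4 * r y)"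
    by (simp add: log_deriv_error_def e_def)
  also have "\<dots> = of_nat n * e - (r y - y) / (2 * (r y)\<^sup>2)"
    using r0 by (simp add: field_simps power2_eq_square)
  finally have L: "log_deriv_error n y = of_nat n * w - (2 * of_nat n * (y - r y) + (r y - y) / (2 * (r y)\<^sup>2))"
    by (simp add: e_def w_def resolvent_error_def algebra_simps)
  have A: "leading_term n y \<noteq> 0" by (rule leading_term_nonzero[OF n y])
  show ?thesis unfolding L
    by (rule DERIV_cong[OF DERIV_divide[OF scaled_hermite_deriv[OF n y] leading_term_deriv[OF n y] A]])
       (use A in \<open>simp add: w_def field_simps\<close>)
qed


lemma ratio_tendsto_at_infinity:
  assumes n: "n > 0"
  shows "((\<lambda>y. scaled_hermite n y / leading_term n y) \<longlongrightarrow> 1) at_infinity"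
proof -
  define c where "c = complex_of_real (sqrt (2 * real n))"
  define K where "K = complex_of_real ((real n / (2 * exp 1)) powr (real n / 2))"
  have c0: "c \<noteq> 0" using n by (simp add: c_def)
  have far: "eventually (\<lambda>y. y \<notin> unit_cut) at_infinity"
    unfolding eventually_at_infinity
  proof (intro exI[of _ 2] allI impI)
    fix y :: complex assume "2 \<le> norm y"
    then show "y \<notin> unit_cut" by (auto simp: cut_iff cmod_eq_Re)
  qed
  have ry: "((\<lambda>y. r y / y) \<longlongrightarrow> 1) at_infinity" using r by (simp add: is_sqrt_branch_def)
  have "((\<lambda>y. 1 + r y / y) \<longlongrightarrow> 1 + 1) at_infinity" by (intro tendsto_intros ry)
  then have s: "((\<lambda>y. 1 + r y / y) \<longlongrightarrow> 2) at_infinity" by simp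
  have "((\<lambda>y. K * (exp (of_nat n * (1 / (1 + r y / y))) * (1 + r y / y) ^ n *
        ((1 + r y / y) / (2 * (r y / y))) powr (1 / 2))) \<longlongrightarrow>
      K * (exp (of_nat n * (1 / 2)) * 2 ^ n * (2 / (2 * 1)) powr (1 / 2))) at_infinity"
    by (intro tendsto_intros s ry tendsto_powr_complex) auto
  moreover have "K * (exp (of_nat n * (1 / 2)) * 2 ^ n * (2 / (2 * 1)) powr (1 / 2)) = c ^ n"
  proof -
    have "K * (exp (of_nat n * (1 / 2)) * 2 ^ n) = of_real
        ((real n / (2 * exp 1)) powr (real n / 2) * (exp (real n / 2) * 2 ^ n))"
      by (simp add: K_def exp_of_real flip: exp_of_real)
    then show ?thesis unfolding leading_constant[OF n] by (simp add: c_def)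
  qed
  ultimately have "((\<lambda>y. K * (exp (of_nat n * (1 / (1 + r y / y))) * (1 + r y / y) ^ n *
        ((1 + r y / y) / (2 * (r y / y))) powr (1 / 2))) \<longlongrightarrow> c ^ n) at_infinity"
    by simp
  then have lead: "((\<lambda>y. leading_term n y / y ^ n) \<longlongrightarrow> c ^ n) at_infinity"
  proof (rule Lim_transform_eventually)
    show "eventually (\<lambda>y. K * (exp (of_nat n * (1 / (1 + r y / y))) * (1 + r y / y) ^ n *
        ((1 + r y / y) / (2 * (r y / y))) powr (1 / 2)) = leading_term n y / y ^ n) at_infinity"
      using far
    proof eventually_elim
      case (elim y)
      have y0: "y \<noteq> 0" using elim by (auto simp: cut_iff)
      have p0: "y + r y \<noteq> 0" by (rule branch_sum_nonzero[OF elim])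
      have 1: "1 + r y / y = (y + r y) / y" using y0 by (simp add: field_simps)
      have "1 / (1 + r y / y) = y * (1 / (y + r y))" unfolding 1 by simp
      also have "1 / (y + r y) = y - r y" using branch_conj[OF elim] p0 by (simp add: field_simps)
      finally have 2: "1 / (1 + r y / y) = y\<^sup>2 - y * r y" by (simp add: algebra_simps power2_eq_square)
      have 3: "(1 + r y / y) / (2 * (r y / y)) = (y + r y) / (2 * r y)" unfolding 1 using y0 by simp
      show ?case unfolding 2 3 unfolding 1 by (simp add: leading_term_def K_def power_divide)
    qed
  qed
  have "filterlim (\<lambda>y. c * y) at_infinity at_infinity"
    by (rule tendsto_mult_filterlim_at_infinity[OF tendsto_const c0 filterlim_ident])
  then have "((\<lambda>y. poly (monic_hermite n) (c * y) / (c * y) ^ n) \<longlongrightarrow> 1) at_infinity"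
    by (rule filterlim_compose[OF monic_hermite_leading_power])
  then have "((\<lambda>y. poly (monic_hermite n) (c * y) / (c * y) ^ n * (c ^ n / (leading_term n y / y ^ n)))
      \<longlongrightarrow> 1 * (c ^ n / c ^ n)) at_infinity"
    using c0 by (intro tendsto_intros lead) auto
  then have "((\<lambda>y. poly (monic_hermite n) (c * y) / (c * y) ^ n * (c ^ n / (leading_term n y / y ^ n)))
      \<longlongrightarrow> 1) at_infinity" using c0 by simp
  then show ?thesis
  proof (rule Lim_transform_eventually)
    show "eventually (\<lambda>y. poly (monic_hermite n) (c * y) / (c * y) ^ n * (c ^ n / (leading_term n y / y ^ n))
        = scaled_hermite n y / leading_term n y) at_infinity"
      using far
    proof eventually_elim
      case (elim y)
      have "y \<noteq> 0" using elim by (auto simp: cut_iff)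
      then show ?case using c0
        by (simp add: scaled_hermite_def c_def[symmetric] power_mult_distrib)
    qed
  qed
qed

text \<open>Along \<open>t \<mapsto> t y\<close> the logarithmic derivative of the quotient is at most
  \<open>|y| \<cdot> C/(n t\<^sup>2 |y|\<^sup>2) \<le> (C/(n \<eta>))/t\<^sup>2\<close>, as \<open>|y| \<ge> \<eta>\<close>.\<close>

lemma ratio_error:
  assumes n: "n > 0" and "\<eta> > 0" "C \<ge> 0" and small: "C / real n / \<eta> \<le> 1 / 2"
    and bound: "\<And>y. \<eta> \<le> infdist y unit_cut \<Longrightarrow> norm (log_deriv_error n y) \<le> C / real n / norm y ^ 2"
    and dist: "\<eta> \<le> infdist y unit_cut"
  shows "norm (scaled_hermite n y / leading_term n y - 1) \<le> 2 * (C / real n / \<eta>)"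
proof -
  define g where "g = (\<lambda>y. scaled_hermite n y / leading_term n y)"
  have y1: "norm y \<ge> \<eta>" using norm_ge_infdist_cut[of y] dist by linarith
  have y0: "norm y > 0" using y1 \<open>\<eta> > 0\<close> by linarith
  have far: "\<eta> \<le> infdist (of_real t * y) unit_cut" if "t \<ge> 1" for t
    using infdist_cut_scale[OF that, of y] dist by linarith
  have "norm (g (of_real 1 * y) - 1) \<le> 2 * (C / real n / \<eta>)"
  proof (rule norm_start_minus_limit_le[where G = "\<lambda>t. g (of_real t * y)" and
        G' = "\<lambda>t. y * (log_deriv_error n (of_real t * y) * g (of_real t * y))"])
    fix t :: real assume t: "t \<ge> 1"
    have cut: "of_real t * y \<notin> unit_cut" using far[OF t] \<open>\<eta> > 0\<close> notin_cut_of_infdist by blast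
    have "((\<lambda>t. of_real t * y) has_vector_derivative y) (at t)"
      by (auto intro!: derivative_eq_intros)
    from field_vector_diff_chain_at[OF this ratio_deriv[OF n cut]]
    show "((\<lambda>t. g (of_real t * y)) has_vector_derivative
        y * (log_deriv_error n (of_real t * y) * g (of_real t * y))) (at t)"
      by (simp add: g_def o_def)
    have "norm y * norm (log_deriv_error n (of_real t * y)) \<le> norm y * (C / real n / norm (of_real t * y) ^ 2)"
      by (intro mult_left_mono bound far t) simp
    also have "\<dots> = C / real n / norm y / t\<^sup>2"
      using y0 t by (simp add: norm_mult power_mult_distrib) (simp add: power2_eq_square)
    also have "\<dots> \<le> C / real n / \<eta> / t\<^sup>2"
      using y1 y0 \<open>C \<ge> 0\<close> \<open>\<eta> > 0\<close> by (intro divide_right_mono divide_left_mono) auto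
    finally have "norm y * norm (log_deriv_error n (of_real t * y)) \<le> C / real n / \<eta> / t\<^sup>2" .
    from mult_right_mono[OF this norm_ge_zero[of "g (of_real t * y)"]]
    show "norm (y * (log_deriv_error n (of_real t * y) * g (of_real t * y)))
        \<le> C / real n / \<eta> / t\<^sup>2 * norm (g (of_real t * y))"
      by (simp add: norm_mult mult.assoc)
  next
    have "filterlim (\<lambda>t. y * complex_of_real t) at_infinity at_top"
      using y0 by (intro tendsto_mult_filterlim_at_infinity[OF tendsto_const] filterlim_of_real_at_infinity) auto
    then have "filterlim (\<lambda>t. of_real t * y) at_infinity at_top" by (simp add: mult.commute)
    then show "((\<lambda>t. g (of_real t * y)) \<longlongrightarrow> 1) at_top"
      unfolding g_def by (rule filterlim_compose[OF ratio_tendsto_at_infinity[OF n]])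
  qed (use assms in auto)
  then show ?thesis by (simp add: g_def)
qed

lemma leading_term_eq:
  assumes y: "y \<notin> unit_cut"
  shows "leading_term n y = of_real ((real n / (2 * exp 1)) powr (real n / 2)) *
     exp (of_nat n * (y\<^sup>2 - y * r y + Ln (y + r y))) * ((y + r y) / (2 * r y)) powr (1 / 2)"
proof -
  have "exp (of_nat n * (y\<^sup>2 - y * r y + Ln (y + r y))) =
      exp (of_nat n * (y\<^sup>2 - y * r y)) * exp (Ln (y + r y)) ^ n"
    by (simp only: distrib_left exp_add exp_of_nat_mult)
  also have "exp (Ln (y + r y)) = y + r y" by (rule exp_Ln[OF branch_sum_nonzero[OF y]])
  finally show ?thesis by (simp add: leading_term_def)
qed

end

section \<open>The uniform asymptotic formula\<close>

theorem theorem3p1: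
  fixes r :: "complex \<Rightarrow> complex" and \<eta> :: real
  assumes "is_sqrt_branch r" and "\<eta> > 0"
  shows "uniform_limit {y. infdist y unit_cut \<ge> \<eta>}
           (\<lambda>n y. poly (monic_hermite n) (complex_of_real (sqrt (2 * real n)) * y) /
              (complex_of_real ((real n / (2 * exp 1)) powr (real n / 2)) *
               exp (of_nat n * (y\<^sup>2 - y * r y + Ln (y + r y))) *
               ((y + r y) / (2 * r y)) powr (1 / 2)))
           (\<lambda>_. 1) sequentially"
proof (rule uniform_limitI)
  fix e :: real assume "e > 0"
  obtain C where "C \<ge> 0" and C: "\<And>n y. n > 0 \<Longrightarrow> \<eta> \<le> infdist y unit_cut \<Longrightarrow>
      norm (log_deriv_error r n y) \<le> C / real n / norm y ^ 2"
    using log_deriv_error_decay[OF assms] by auto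
  have "(\<lambda>n. C / real n / \<eta>) \<longlonglongrightarrow> 0 / \<eta>"
    using assms by (intro tendsto_divide lim_const_over_n) auto
  then have "eventually (\<lambda>n. C / real n / \<eta> < min (1 / 2) (e / 2)) sequentially"
    by (rule order_tendstoD) (use \<open>e > 0\<close> in auto)
  then show "\<forall>\<^sub>F n in sequentially. \<forall>y\<in>{y. infdist y unit_cut \<ge> \<eta>}.
      dist (poly (monic_hermite n) (complex_of_real (sqrt (2 * real n)) * y) /
              (complex_of_real ((real n / (2 * exp 1)) powr (real n / 2)) *
               exp (of_nat n * (y\<^sup>2 - y * r y + Ln (y + r y))) *
               ((y + r y) / (2 * r y)) powr (1 / 2))) 1 < e"
    using eventually_gt_at_top[of 0]
  proof eventually_elim
    case (elim n)
    show ?case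
    proof safe
      fix y assume y: "\<eta> \<le> infdist y unit_cut"
      have cut: "y \<notin> unit_cut" using y assms(2) notin_cut_of_infdist by blast
      have "norm (scaled_hermite n y / leading_term r n y - 1) \<le> 2 * (C / real n / \<eta>)"
        by (rule ratio_error[OF assms(1)]) (use elim assms \<open>C \<ge> 0\<close> C y in auto)
      also have "\<dots> < e" using elim by linarith
      finally show "dist (poly (monic_hermite n) (complex_of_real (sqrt (2 * real n)) * y) /
              (complex_of_real ((real n / (2 * exp 1)) powr (real n / 2)) *
               exp (of_nat n * (y\<^sup>2 - y * r y + Ln (y + r y))) *
               ((y + r y) / (2 * r y)) powr (1 / 2))) 1 < e"
        unfolding leading_term_eq[OF assms(1) cut] scaled_hermite_def dist_norm .
    qed
  qed
qed

end
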